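(* Let $A$ be a commutative complex Banach algebra with unit element $\mathbf{1}$, let $X$ be a nonempty set, and let $f:X\to A$ be a function. Then $$\vec{\mathrm{sp}}(f)=\{\phi\circ f:\phi\in\mathfrak{M}(A)\}.$$
   Context: $\mathfrak{M}(A)$ denotes the character space of $A$, i.e. the set of nonzero complex algebra homomorphisms $A\to\mathbb{C}$. The vector-valued spectrum $\vec{\mathrm{sp}}(f)$ of a function $f:X\to A$ is the set of all functions $\lambda:X\to\mathbb{C}$ such that, for every finite subset $F\subset X$, $\mathbf{1}\notin\sum_{x\in F}A\,(\lambda(x)\mathbf{1}-f(x))$. Equivalently, $\lambda\notin\vec{\mathrm{sp}}(f)$ if and only if there exist $x_1,\dots,x_n\in X$ and $a_1,\dots,a_n\in A$ with $\mathbf{1}=\sum_{i=1}^n a_i(\lambda(x_i)\mathbf{1}-f(x_i))$. *)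

theory Defs
  imports "HOL-Analysis.Analysis"
begin

text \<open>
  The library has no classes for complex scalar multiplication, so it is added here on top of
  the real Banach algebra classes, subject to agreeing with the real scalar multiplication.
  Neither \<open>norm 1 = 1\<close> nor \<open>0 \<noteq> 1\<close> is required, hence the use of
  \<open>comm_monoid_mult\<close> instead of \<open>comm_ring_1\<close> and \<open>real_normed_algebra_1\<close>.
\<close>

class comm_complex_banach_algebra = real_normed_algebra + banach + comm_ring + comm_monoid_mult +
  fixes scaleC :: "complex \<Rightarrow> 'a \<Rightarrow> 'a" (infixr "*\<^sub>C" 75)
  assumes scaleC_add_right: "c *\<^sub>C (x + y) = c *\<^sub>C x + c *\<^sub>C y"
    and scaleC_add_left: "(c + d) *\<^sub>C x = c *\<^sub>C x + d *\<^sub>C x"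
    and scaleC_scaleC: "c *\<^sub>C (d *\<^sub>C x) = (c * d) *\<^sub>C x"
    and scaleC_of_real: "complex_of_real r *\<^sub>C x = r *\<^sub>R x"
    and mult_scaleC_left: "(c *\<^sub>C x) * y = c *\<^sub>C (x * y)"
    and norm_scaleC: "norm (c *\<^sub>C x) = cmod c * norm x"

instantiation complex :: comm_complex_banach_algebra
begin

definition scaleC_complex :: "complex \<Rightarrow> complex \<Rightarrow> complex"
  where "scaleC_complex c x = c * x"

instance
  by standard (simp_all add: scaleC_complex_def algebra_simps norm_mult scaleR_conv_of_real)

end

definition character_space :: "('a::comm_complex_banach_algebra \<Rightarrow> complex) set"
  where "character_space =
    {\<phi>. \<phi> \<noteq> (\<lambda>_. 0) \<and>
         (\<forall>x y. \<phi> (x + y) = \<phi> x + \<phi> y) \<and>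
         (\<forall>c x. \<phi> (c *\<^sub>C x) = c * \<phi> x) \<and>
         (\<forall>x y. \<phi> (x * y) = \<phi> x * \<phi> y)}"

definition vector_spectrum ::
    "('x \<Rightarrow> 'a::comm_complex_banach_algebra) \<Rightarrow> ('x \<Rightarrow> complex) set"
  where "vector_spectrum f =
    {\<mu>. \<forall>F. finite F \<longrightarrow>
       1 \<notin> {\<Sum>x\<in>F. a x * (\<mu> x *\<^sub>C 1 - f x) | a. True}}"

end

theory Submission
  imports Defs
begin

text \<open>
  One inclusion is immediate: a character \<open>\<phi>\<close> sends every
  \<open>\<phi> (f x) 1 - f x\<close> to \<open>0\<close> and \<open>1\<close> to \<open>1\<close>, so no linear combination of these
  elements equals \<open>1\<close>. Conversely, \<open>\<mu>\<close> lies in the spectrum exactly when the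
  ideal generated by the elements \<open>\<mu> x 1 - f x\<close> is proper. By Zorn's lemma it is then
  contained in a maximal ideal \<open>I\<close>, and every maximal ideal is the kernel of a character
  (\<open>maximal_ideal_character\<close>). This character takes \<open>f x\<close> to \<open>\<mu> x\<close>.

  That the quotient by \<open>I\<close> consists of scalars only is the Gelfand--Mazur theorem. Instead of a
  quotient algebra, the proof works in \<open>A\<close> with the quotient seminorm \<open>N x = infdist x I\<close>,
  which is homogeneous and submultiplicative. Completeness enters only through the
  Neumann series, which keeps \<open>I\<close> at distance at least \<open>1\<close> from the unit, so that
  \<open>N\<close> is not identically \<open>0\<close>.

  Gelfand--Mazur is proved without linear functionals or integration. If \<open>u 1 - a\<close> has an
  inverse \<open>b u\<close> modulo the kernel of \<open>N\<close> for every complex \<open>u\<close>, then \<open>u \<mapsto> N (b u)\<close>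
  is positive, continuous and tends to \<open>0\<close> at infinity, so it attains its maximum. It also obeys
  an approximate mean value inequality over \<open>n\<close> equally spaced points of a small circle, with
  an error that decays geometrically in \<open>n\<close> (\<open>res_norm_mean_value\<close>). Hence a maximum at one point
  spreads to all points within a fixed distance, and by repetition arbitrarily far out, which
  contradicts the decay.
\<close>

section \<open>Complex scalars\<close>

lemma scaleC_one: "1 *\<^sub>C x = (x::'a::comm_complex_banach_algebra)"
  using scaleC_of_real[of 1 x] by simp

lemma scaleC_eq_mult: "c *\<^sub>C x = (c *\<^sub>C 1) * (x::'a::comm_complex_banach_algebra)"
  by (simp add: mult_scaleC_left)

text \<open>
  With the ring homomorphism \<open>scalar\<close>, statements about \<open>scaleC\<close> become ring identities.
\<close>

definition scalar :: "complex \<Rightarrow> 'a::comm_complex_banach_algebra"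
  where "scalar c = c *\<^sub>C 1"

lemma scaleC_scalar: "c *\<^sub>C x = scalar c * x"
  unfolding scalar_def by (rule scaleC_eq_mult)

lemma norm_scalar_mult: "norm (scalar c * x) = cmod c * norm x"
  by (metis scaleC_scalar norm_scaleC)

lemma scalar_add: "scalar (c + d) = scalar c + scalar d"
  by (simp add: scalar_def scaleC_add_left)

lemma scalar_1 [simp]: "scalar 1 = 1"
  by (simp add: scalar_def scaleC_one)

lemma scalar_0 [simp]: "scalar 0 = 0"
  using scalar_add[of 0 0] by simp

lemma scalar_minus: "scalar (- c) = - scalar c"
  using scalar_add[of c "- c"] by (simp add: eq_neg_iff_add_eq_0 add.commute)

lemma scalar_diff: "scalar (c - d) = scalar c - scalar d"
  using scalar_add[of c "- d"] by (simp add: scalar_minus)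

lemma scalar_mult: "scalar (c * d) = scalar c * scalar d"
  by (simp add: scalar_def mult_scaleC_left scaleC_scaleC)

lemma scalar_power: "scalar (c ^ n) = scalar c ^ n"
  by (induction n) (simp_all add: scalar_mult)

lemma scalar_sum: "scalar (sum g A) = (\<Sum>x\<in>A. scalar (g x))"
  by (induction A rule: infinite_finite_induct) (simp_all add: scalar_add)

lemma one_minus_mult_geometric_sum:
  fixes x :: "'a::comm_complex_banach_algebra"
  shows "(1 - x) * (\<Sum>j<n. x ^ j) = 1 - x ^ n"
proof (induction n)
  case (Suc n)
  have "(1 - x) * (\<Sum>j<Suc n. x ^ j) = (1 - x) * (\<Sum>j<n. x ^ j) + (1 - x) * x ^ n"
    by (simp add: distrib_left)
  also have "\<dots> = 1 - x ^ Suc n"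
    unfolding Suc by (simp add: left_diff_distrib)
  finally show ?case .
qed simp

lemma root_of_unity_power:
  assumes "n > 0"
  shows "cis (2 * pi * real k / real n) ^ n = 1"
proof -
  have "cis (2 * pi * real k / real n) ^ n = cis (2 * pi * real k)"
    using assms by (simp add: Complex.DeMoivre)
  also have "\<dots> = 1" by (rule cis_multiple_2pi) simp
  finally show ?thesis .
qed

lemma sum_powers_root_of_unity:
  assumes "j < n"
  shows "(\<Sum>k<n. (cis (2 * pi * real k / real n)) ^ j) = (if j = 0 then of_nat n else 0)"
proof (cases "j = 0")
  case False
  let ?w = "cis (2 * pi * real j / real n)"
  have n: "n > 0" using assms by simp
  have "inj_on (\<lambda>k. cis (2 * pi * real k / real n)) {..<n}"
    using Complex.bij_betw_roots_unity[OF n] by (simp add: bij_betw_def)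
  then have "?w \<noteq> cis (2 * pi * real 0 / real n)"
    using assms False n by (meson inj_onD lessThan_iff)
  then have w1: "?w \<noteq> 1" by simp
  have "?w ^ n = 1" using n by (rule root_of_unity_power)
  then have "(\<Sum>k<n. ?w ^ k) = 0"
    using w1 by (simp add: geometric_sum)
  moreover have "(cis (2 * pi * real k / real n)) ^ j = ?w ^ k" for k
    by (simp add: Complex.DeMoivre algebra_simps)
  ultimately show ?thesis using False by simp
qed simp

text \<open>
  After exchanging the sums, orthogonality of the \<open>n\<close>-th roots of unity removes every power
  of \<open>c\<close> except the zeroth.
\<close>

lemma sum_geometric_sums_roots_of_unity:
  fixes c :: "'a::comm_complex_banach_algebra"
  assumes "n > 0"
  shows "(\<Sum>k<n. \<Sum>j<n. (scalar (cis (2 * pi * real k / real n)) * c) ^ j) = scalar (of_nat n)"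
proof -
  have "(\<Sum>k<n. \<Sum>j<n. (scalar (cis (2 * pi * real k / real n)) * c) ^ j)
      = (\<Sum>j<n. scalar (\<Sum>k<n. (cis (2 * pi * real k / real n)) ^ j) * c ^ j)"
    unfolding scalar_sum sum_distrib_right
    by (subst sum.swap) (simp add: power_mult_distrib scalar_power)
  also have "\<dots> = (\<Sum>j<n. if j = 0 then scalar (of_nat n) else 0)"
    by (rule sum.cong) (auto simp: sum_powers_root_of_unity)
  also have "\<dots> = scalar (of_nat n)"
    using assms by (simp add: sum.delta)
  finally show ?thesis .
qed

section \<open>Gelfand--Mazur for algebra seminorms\<close>

locale algebra_seminorm =
  fixes N :: "'a::comm_complex_banach_algebra \<Rightarrow> real"
  assumes triangle: "N (x + y) \<le> N x + N y"
    and scale: "N (scalar c * x) = cmod c * N x"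
    and submult: "N (x * y) \<le> N x * N y"
begin

lemma zero [simp]: "N 0 = 0"
  using scale[of 0 0] by simp

lemma minus [simp]: "N (- x) = N x"
  using scale[of "-1" x] by (simp add: scalar_minus)

lemma diff_le: "N (x - y) \<le> N x + N y"
  using triangle[of x "- y"] by simp

lemma nonneg [simp]: "0 \<le> N x"
  using diff_le[of x x] by simp

lemma kernel_mult: "N x = 0 \<Longrightarrow> N (x * y) = 0"
  using submult[of x y] nonneg[of "x * y"] by simp

lemma sum_le: "N (sum g A) \<le> (\<Sum>x\<in>A. N (g x))"
proof (induction A rule: infinite_finite_induct)
  case (insert x A)
  then show ?case using triangle[of "g x" "sum g A"] by simp
qed simp_all

lemma power_le: "n > 0 \<Longrightarrow> N (x ^ n) \<le> N x ^ n"
proof (induction n)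
  case (Suc n)
  show ?case
  proof (cases "n = 0")
    case False
    have "N (x ^ Suc n) \<le> N x * N (x ^ n)" using submult by simp
    also have "\<dots> \<le> N x * N x ^ n"
      using Suc False by (intro mult_left_mono) auto
    finally show ?thesis by simp
  qed simp
qed simp

lemma kernel_sum: "(\<And>x. x \<in> A \<Longrightarrow> N (g x) = 0) \<Longrightarrow> N (sum g A) = 0"
  using sum_le[of g A] nonneg[of "sum g A"] by simp

end

text \<open>
  The situation to be refuted: \<open>a\<close> has empty spectrum modulo the kernel of \<open>N\<close>. The
  function \<open>b\<close> is an arbitrary choice of inverses, and need not be continuous; only the values
  \<open>N (b u)\<close> are well behaved.
\<close>

locale everywhere_resolvent = algebra_seminorm +
  fixes a :: "'a::comm_complex_banach_algebra" and b :: "complex \<Rightarrow> 'a"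
  assumes one_pos: "N 1 > 0"
    and inverse: "N (1 - b u * (scalar u - a)) = 0"
begin

definition res_norm :: "complex \<Rightarrow> real" where "res_norm u = N (b u)"

lemma resolvent_identity:
  "N (b u - b v - scalar (v - u) * (b u * b v)) = 0"
proof -
  have "b u - b v - scalar (v - u) * (b u * b v)
      = (1 - b v * (scalar v - a)) * b u - (1 - b u * (scalar u - a)) * b v"
    by (simp add: scalar_diff algebra_simps)
  then show ?thesis
    using diff_le[of "(1 - b v * (scalar v - a)) * b u" "(1 - b u * (scalar u - a)) * b v"]
      kernel_mult[OF inverse] nonneg
    by (metis add_0 order_antisym)
qed

lemma res_norm_diff_le: "\<bar>res_norm u - res_norm v\<bar> \<le> cmod (v - u) * (res_norm u * res_norm v)"
proof -
  have "N (b u - b v) \<le> N (b u - b v - scalar (v - u) * (b u * b v))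
      + N (scalar (v - u) * (b u * b v))"
    using triangle[of "b u - b v - scalar (v - u) * (b u * b v)" "scalar (v - u) * (b u * b v)"]
    by simp
  also have "\<dots> = cmod (v - u) * N (b u * b v)"
    by (simp add: resolvent_identity scale)
  also have "\<dots> \<le> cmod (v - u) * (res_norm u * res_norm v)"
    unfolding res_norm_def by (intro mult_left_mono submult) simp
  finally have d: "N (b u - b v) \<le> cmod (v - u) * (res_norm u * res_norm v)" .
  have "res_norm u - res_norm v \<le> N (b u - b v)"
    unfolding res_norm_def using triangle[of "b u - b v" "b v"] by simp
  moreover have "res_norm v - res_norm u \<le> N (b u - b v)"
    unfolding res_norm_def using diff_le[of "b u" "b u - b v"] by simp
  ultimately show ?thesis using d by linarith
qed

lemma res_norm_pos: "res_norm u > 0"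
proof -
  have "N 1 \<le> N (b u * (scalar u - a))"
    using triangle[of "1 - b u * (scalar u - a)" "b u * (scalar u - a)"] inverse[of u] by simp
  also have "\<dots> \<le> res_norm u * N (scalar u - a)"
    unfolding res_norm_def by (rule submult)
  finally have "res_norm u \<noteq> 0" using one_pos by auto
  then show ?thesis using nonneg[of "b u"] unfolding res_norm_def by linarith
qed

text \<open>
  The bound \<open>res_norm_diff_le\<close> still contains the unknown value at \<open>u\<close>. Near \<open>v\<close> it first
  gives \<open>res_norm u \<le> 2 * res_norm v\<close>, and inserting this makes it a Lipschitz bound.
\<close>

lemma isCont_res_norm: "isCont res_norm v"
proof -
  have bound: "\<bar>res_norm u - res_norm v\<bar> \<le> cmod (v - u) * (2 * res_norm v * res_norm v)"
    if "cmod (v - u) < 1 / (2 * res_norm v)" for u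
  proof -
    have "res_norm u \<le> res_norm v + (cmod (v - u) * res_norm v) * res_norm u"
      using res_norm_diff_le[of u v] by (simp add: algebra_simps)
    also have "\<dots> \<le> res_norm v + (1/2) * res_norm u"
      using that res_norm_pos[of u] res_norm_pos[of v]
      by (intro add_left_mono mult_right_mono) (auto simp: field_simps)
    finally have "res_norm u \<le> 2 * res_norm v" by simp
    then have "cmod (v - u) * (res_norm u * res_norm v) \<le> cmod (v - u) * (2 * res_norm v * res_norm v)"
      using res_norm_pos[of v] by (intro mult_left_mono mult_right_mono) auto
    then show ?thesis using res_norm_diff_le[of u v] by linarith
  qed
  have "eventually (\<lambda>u. cmod (v - u) < 1 / (2 * res_norm v)) (at v)"
    using res_norm_pos[of v] by (auto simp: eventually_at dist_norm norm_minus_commute intro!: exI[of _ "1 / (2 * res_norm v)"])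
  then have ev: "eventually (\<lambda>u. norm (res_norm u - res_norm v) \<le> cmod (v - u) * (2 * res_norm v * res_norm v)) (at v)"
    by (rule eventually_mono) (simp only: real_norm_def bound)
  have "((\<lambda>u. cmod (v - u) * (2 * res_norm v * res_norm v)) \<longlongrightarrow> cmod (v - v) * (2 * res_norm v * res_norm v)) (at v)"
    by (intro tendsto_intros)
  then have "((\<lambda>u. cmod (v - u) * (2 * res_norm v * res_norm v)) \<longlongrightarrow> 0) (at v)" by simp
  then have "((\<lambda>u. res_norm u - res_norm v) \<longlongrightarrow> 0) (at v)"
    by (rule Lim_null_comparison[OF ev])
  then show ?thesis
    by (simp add: isCont_def LIM_zero_iff)
qed

text \<open>
  Decay at infinity: modulo the kernel, \<open>u b(u) = 1 + b(u) a\<close>, so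
  \<open>(\<bar>u\<bar> - N a) N (b u) \<le> N 1\<close>.
\<close>

lemma res_norm_less:
  assumes e: "e > 0" and u: "cmod u > N a + N 1 / e"
  shows "res_norm u < e"
proof (rule ccontr)
  assume "\<not> res_norm u < e"
  have "scalar u * b u = 1 + b u * a - (1 - b u * (scalar u - a))"
    by (simp add: algebra_simps)
  then have "cmod u * res_norm u \<le> N (1 + b u * a)"
    using diff_le[of "1 + b u * a" "1 - b u * (scalar u - a)"] inverse[of u] scale[of u "b u"]
    by (simp add: res_norm_def)
  also have "\<dots> \<le> N 1 + res_norm u * N a"
    using triangle[of 1 "b u * a"] submult[of "b u" a] by (simp add: res_norm_def)
  finally have "res_norm u * (cmod u - N a) \<le> N 1" by (simp add: algebra_simps)
  moreover have "N 1 < e * (cmod u - N a)"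
    using e u by (simp add: field_simps)
  moreover have "N 1 / e > 0" using e one_pos by simp
  then have "e * (cmod u - N a) \<le> res_norm u * (cmod u - N a)"
    using \<open>\<not> res_norm u < e\<close> u by (intro mult_right_mono) auto
  ultimately show False by linarith
qed

text \<open>
  Let \<open>c = - z b(u)\<close> and \<open>w\<^sub>k\<close> the \<open>n\<close>-th roots of unity. The resolvent identity says
  \<open>b (u + z w\<^sub>k) (1 - w\<^sub>k c) = b u\<close> modulo the kernel. Multiplying by the geometric sum in
  \<open>w\<^sub>k c\<close> turns the factor into \<open>1 - c\<^sup>n\<close>, which no longer depends on \<open>k\<close>, and summing
  over \<open>k\<close> leaves \<open>n b u\<close> on the right. Hence the resolvent at the centre is its average over
  the circle up to a relative error \<open>N (c\<^sup>n)\<close>.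
\<close>

lemma res_norm_mean_value:
  assumes "n > 0"
  shows "real n * res_norm u \<le>
    (\<Sum>k<n. res_norm (u + z * cis (2 * pi * real k / real n))) * (1 + (cmod z * res_norm u) ^ n)"
proof -
  define w where "w k = cis (2 * pi * real k / real n)" for k
  define c where "c = scalar (- z) * b u"
  define v where "v k = u + z * w k" for k
  \<comment> \<open>the elements \<open>d k\<close> lie in the kernel, so all congruences can be handled as equations\<close>
  define d where "d k = b u - b (v k) - scalar (v k - u) * (b u * b (v k))" for k
  define G where "G k = (\<Sum>j<n. (scalar (w k) * c) ^ j)" for k
  define B where "B = (\<Sum>k<n. b (v k))"
  have wn: "w k ^ n = 1" for k
    unfolding w_def using assms by (rule root_of_unity_power)
  have "b (v k) * (1 - scalar (w k) * c) = b u - d k" for k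
    by (simp add: d_def c_def v_def scalar_mult scalar_add scalar_minus scalar_diff algebra_simps)
  then have "b (v k) * ((1 - scalar (w k) * c) * G k) = b u * G k - d k * G k" for k
    by (metis left_diff_distrib mult.assoc)
  then have "b (v k) * (1 - c ^ n) = b u * G k - d k * G k" for k
    unfolding G_def one_minus_mult_geometric_sum
    by (simp add: power_mult_distrib scalar_power[symmetric] wn)
  then have "B * (1 - c ^ n) = b u * (\<Sum>k<n. G k) - (\<Sum>k<n. d k * G k)"
    by (simp add: B_def sum_distrib_right sum_distrib_left sum_subtractf)
  moreover have "(\<Sum>k<n. G k) = scalar (of_nat n)"
    unfolding G_def w_def using assms by (rule sum_geometric_sums_roots_of_unity)
  ultimately have eq: "scalar (of_nat n) * b u = (B - B * c ^ n) + (\<Sum>k<n. d k * G k)"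
    by (simp add: algebra_simps)
  have "N (\<Sum>k<n. d k * G k) = 0"
    by (intro kernel_sum kernel_mult) (simp add: d_def resolvent_identity)
  then have "real n * res_norm u \<le> N (B - B * c ^ n)"
    using triangle[of "B - B * c ^ n" "\<Sum>k<n. d k * G k"] scale[of "of_nat n" "b u"]
    by (simp add: eq res_norm_def)
  also have "\<dots> \<le> N B + N B * N (c ^ n)"
    using diff_le[of B "B * c ^ n"] submult[of B "c ^ n"] by linarith
  also have "\<dots> \<le> N B + N B * (cmod z * res_norm u) ^ n"
    using power_le[OF assms, of c] scale[of "- z" "b u"]
    by (intro add_left_mono mult_left_mono) (simp_all add: c_def res_norm_def)
  also have "\<dots> = N B * (1 + (cmod z * res_norm u) ^ n)"
    by (simp add: algebra_simps)
  also have "\<dots> \<le> (\<Sum>k<n. res_norm (v k)) * (1 + (cmod z * res_norm u) ^ n)"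
    using sum_le[of "\<lambda>k. b (v k)" "{..<n}"] res_norm_pos[of u]
    by (intro mult_right_mono) (auto simp: B_def res_norm_def)
  finally show ?thesis by (simp add: v_def w_def)
qed

text \<open>
  If the value at \<open>u + z\<close> falls short of the maximum by \<open>g\<close>, then the \<open>n\<close>-point sum
  over the circle through \<open>u + z\<close> falls short of \<open>n\<close> times the maximum by at least \<open>g\<close>. The error
  in the mean value inequality for the sum is at most of order \<open>n / 2\<^sup>n\<close>, so \<open>g\<close> must vanish.
\<close>

lemma maximum_of_res_norm_spreads:
  assumes max: "\<And>v. res_norm v \<le> res_norm u" and z: "cmod z * res_norm u \<le> 1 / 2"
  shows "res_norm (u + z) = res_norm u"
proof (rule ccontr)
  define g where "g = res_norm u - res_norm (u + z)"
  assume "res_norm (u + z) \<noteq> res_norm u"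
  then have g: "g > 0" using max[of "u + z"] by (simp add: g_def)
  have bound: "g \<le> res_norm u * (real n * (1 / 2) ^ n)" if n: "n > 0" for n
  proof -
    let ?S = "\<Sum>k<n. res_norm (u + z * cis (2 * pi * real k / real n))"
    \<comment> \<open>the root of unity with index \<open>0\<close> is \<open>1\<close> and contributes the point \<open>u + z\<close>\<close>
    have "?S = res_norm (u + z) + (\<Sum>k\<in>{..<n} - {0}. res_norm (u + z * cis (2 * pi * real k / real n)))"
      using n by (subst sum.remove[of _ 0]) auto
    also have "\<dots> \<le> res_norm (u + z) + (\<Sum>k\<in>{..<n} - {0}. res_norm u)"
      by (intro add_left_mono sum_mono max)
    also have "\<dots> = real n * res_norm u - g"
      using n by (simp add: g_def algebra_simps of_nat_diff)
    finally have S: "?S \<le> real n * res_norm u - g" .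
    have "0 \<le> cmod z * res_norm u" using res_norm_pos[of u] by (intro mult_nonneg_nonneg) auto
    have "real n * res_norm u \<le> ?S * (1 + (cmod z * res_norm u) ^ n)"
      by (rule res_norm_mean_value[OF n])
    also have "\<dots> \<le> ?S * (1 + (1 / 2) ^ n)"
      using z res_norm_pos \<open>0 \<le> cmod z * res_norm u\<close>
      by (intro mult_left_mono add_left_mono power_mono sum_nonneg) (auto intro: less_imp_le)
    also have "\<dots> \<le> (real n * res_norm u - g) * (1 + (1 / 2) ^ n)"
      using S by (intro mult_right_mono) auto
    also have "\<dots> \<le> real n * res_norm u - g + res_norm u * (real n * (1 / 2) ^ n)"
      using g by (simp add: algebra_simps)
    finally show ?thesis by simp
  qed
  have "(\<lambda>n. res_norm u * (real n * (1 / 2) ^ n)) \<longlonglongrightarrow> res_norm u * 0"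
    by (intro tendsto_mult_left powser_times_n_limit_0) simp
  then have "g \<le> res_norm u * 0"
    by (rule Lim_bounded2[where N = 1]) (simp add: bound)
  then show False using g by simp
qed

lemma res_norm_attains_maximum: "\<exists>u. \<forall>v. res_norm v \<le> res_norm u"
proof -
  \<comment> \<open>outside the disc of this radius, the values stay below the value at \<open>0\<close>\<close>
  define r where "r = N a + N 1 / res_norm 0"
  have "r \<ge> 0" using res_norm_pos[of 0] by (simp add: r_def)
  moreover have "continuous_on (cball 0 r) res_norm"
    by (intro continuous_at_imp_continuous_on) (simp add: isCont_res_norm)
  ultimately have "\<exists>u\<in>cball 0 r. \<forall>v\<in>cball 0 r. res_norm v \<le> res_norm u"
    by (intro continuous_attains_sup) auto
  then obtain u where u: "\<And>v. v \<in> cball 0 r \<Longrightarrow> res_norm v \<le> res_norm u" by blast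
  have "res_norm v \<le> res_norm u" for v
  proof (cases "v \<in> cball 0 r")
    case False
    then have "res_norm v < res_norm 0"
      by (intro res_norm_less res_norm_pos) (simp add: r_def)
    also have "\<dots> \<le> res_norm u" using u[of 0] \<open>r \<ge> 0\<close> by simp
    finally show ?thesis by simp
  qed (rule u)
  then show ?thesis by blast
qed

lemma no_everywhere_resolvent: False
proof -
  obtain u where max: "\<And>v. res_norm v \<le> res_norm u" using res_norm_attains_maximum by blast
  \<comment> \<open>the largest step for which the maximum is known to spread\<close>
  define s where "s = 1 / (2 * res_norm u)"
  have s: "s > 0" using res_norm_pos[of u] by (simp add: s_def)
  have step: "res_norm (u + of_real (real k * s)) = res_norm u" for k
  proof (induction k)
    case (Suc k)
    have "res_norm (u + of_real (real k * s) + of_real s) = res_norm (u + of_real (real k * s))"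
    proof (rule maximum_of_res_norm_spreads)
      show "cmod (of_real s) * res_norm (u + of_real (real k * s)) \<le> 1 / 2"
        unfolding Suc.IH using s res_norm_pos[of u] by (simp only: norm_of_real) (simp add: s_def)
      show "res_norm v \<le> res_norm (u + of_real (real k * s))" for v
        unfolding Suc.IH by (rule max)
    qed
    then show ?case using Suc.IH by (simp add: algebra_simps)
  qed simp
  obtain k :: nat where k: "real k * s > cmod u + N a + N 1 / res_norm u"
    using reals_Archimedean3[OF s] by blast
  define v where "v = u + of_real (real k * s)"
  have "real k * s = cmod (v - u)"
    using s by (simp add: v_def norm_mult)
  also have "\<dots> \<le> cmod v + cmod u" by (rule norm_triangle_ineq4)
  finally have "res_norm v < res_norm u" using k by (intro res_norm_less res_norm_pos) linarith
  then show False using step[of k] by (simp add: v_def)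
qed

end

text \<open>
  For the zero seminorm every element is invertible modulo the kernel, so the unit must have
  positive seminorm.
\<close>

theorem (in algebra_seminorm) gelfand_mazur:
  assumes "N 1 > 0"
  shows "\<exists>u. \<forall>b. N (1 - b * (scalar u - a)) \<noteq> 0"
proof (rule ccontr)
  assume "\<nexists>u. \<forall>b. N (1 - b * (scalar u - a)) \<noteq> 0"
  then have "\<forall>u. \<exists>b. N (1 - b * (scalar u - a)) = 0" by simp
  then obtain b where "\<And>u. N (1 - b u * (scalar u - a)) = 0" by metis
  then interpret everywhere_resolvent N a b
    using assms by unfold_locales
  show False by (rule no_everywhere_resolvent)
qed

section \<open>Ideals and the quotient seminorm\<close>

definition ring_ideal :: "'a::comm_complex_banach_algebra set \<Rightarrow> bool"
  where "ring_ideal I \<longleftrightarrow>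
    0 \<in> I \<and> (\<forall>x\<in>I. \<forall>y\<in>I. x + y \<in> I) \<and> (\<forall>a. \<forall>x\<in>I. a * x \<in> I)"

lemma ring_idealD:
  assumes "ring_ideal I"
  shows "0 \<in> I" "x \<in> I \<Longrightarrow> y \<in> I \<Longrightarrow> x + y \<in> I" "x \<in> I \<Longrightarrow> a * x \<in> I" "x \<in> I \<Longrightarrow> x * a \<in> I"
  using assms by (auto simp: ring_ideal_def mult.commute)

lemma ring_ideal_diff:
  assumes "ring_ideal I" "x \<in> I" "y \<in> I"
  shows "x - y \<in> I"
  using ring_idealD(2)[OF assms(1,2) ring_idealD(3)[OF assms(1,3), of "- 1"]] by simp

text \<open>
  The Neumann series. The norm of the unit may differ from \<open>1\<close>, so the powers of \<open>x\<close> are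
  bounded with the extra factor \<open>norm 1\<close>.
\<close>

lemma one_minus_invertible:
  fixes x :: "'a::comm_complex_banach_algebra"
  assumes "norm x < 1"
  shows "\<exists>s. (1 - x) * s = 1"
proof -
  have le: "norm (x ^ n) \<le> norm (1::'a) * norm x ^ n" for n
  proof (induction n)
    case (Suc n)
    have "norm (x ^ Suc n) \<le> norm x * norm (x ^ n)" by (simp add: norm_mult_ineq)
    also have "\<dots> \<le> norm x * (norm (1::'a) * norm x ^ n)"
      by (intro mult_left_mono Suc) simp
    finally show ?case by (simp add: algebra_simps)
  qed simp
  have "summable (\<lambda>n. norm (1::'a) * norm x ^ n)"
    using assms by (intro summable_mult summable_geometric) simp
  then have sm: "summable (\<lambda>n. x ^ n)"
    by (rule summable_comparison_test') (rule le)
  then have "(\<lambda>n. (1 - x) * (\<Sum>j<n. x ^ j)) \<longlonglongrightarrow> (1 - x) * (\<Sum>j. x ^ j)"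
    by (intro tendsto_mult_left summable_LIMSEQ)
  moreover have "(\<lambda>n. 1 - x ^ n) \<longlonglongrightarrow> 1 - 0"
    by (intro tendsto_diff tendsto_const summable_LIMSEQ_zero sm)
  ultimately have "(1 - x) * (\<Sum>j. x ^ j) = 1"
    unfolding one_minus_mult_geometric_sum using LIMSEQ_unique by fastforce
  then show ?thesis by blast
qed

lemma infdist_less_iff:
  assumes "I \<noteq> {}"
  shows "infdist x I < e \<longleftrightarrow> (\<exists>i\<in>I. norm (x - i) < e)"
  using assms
  by (simp add: infdist_notempty dist_norm[symmetric])
    (subst cINF_less_iff, auto intro: bdd_belowI2[of _ 0])

text \<open>
  An element of \<open>I\<close> closer to \<open>1\<close> would be invertible by the Neumann series, and so
  would force \<open>1 \<in> I\<close>.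
\<close>

lemma one_le_infdist_one:
  fixes I :: "'a::comm_complex_banach_algebra set"
  assumes I: "ring_ideal I" and 1: "1 \<notin> I"
  shows "1 \<le> infdist 1 I"
proof (rule ccontr)
  assume "\<not> 1 \<le> infdist 1 I"
  moreover have "I \<noteq> {}" using ring_idealD(1)[OF I] by blast
  ultimately obtain i where i: "i \<in> I" "norm (1 - i) < 1"
    using infdist_less_iff[of I 1 1] by auto
  then obtain s where "i * s = 1"
    using one_minus_invertible[of "1 - i"] by auto
  then show False using ring_idealD(4)[OF I i(1), of s] 1 by simp
qed

text \<open>
  This is the quotient seminorm of \<open>A / I\<close>. The infimum need not be attained, so each
  inequality is shown for approximants up to \<open>e\<close>, and then \<open>e\<close> tends to \<open>0\<close>.
\<close>

lemma algebra_seminorm_infdist: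
  fixes I :: "'a::comm_complex_banach_algebra set"
  assumes I: "ring_ideal I"
  shows "algebra_seminorm (\<lambda>x. infdist x I)"
proof
  have ne: "I \<noteq> {}" using ring_idealD(1)[OF I] by blast
  have near: "\<exists>i\<in>I. norm (x - i) < infdist x I + e" if "e > 0" for x e
    using infdist_less_iff[OF ne, of x "infdist x I + e"] that by simp
  have le: "infdist x I \<le> norm (x - i)" if "i \<in> I" for x i
    using infdist_le[OF that, of x] by (simp add: dist_norm)
  show "infdist (x + y) I \<le> infdist x I + infdist y I" for x y
  proof (rule field_le_epsilon)
    fix e :: real assume "e > 0"
    then obtain i j where ij: "i \<in> I" "j \<in> I"
      "norm (x - i) < infdist x I + e/2" "norm (y - j) < infdist y I + e/2"
      using near[of "e/2"] by (metis half_gt_zero)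
    have "infdist (x + y) I \<le> norm ((x + y) - (i + j))"
      by (intro le ring_idealD(2)[OF I] ij)
    also have "\<dots> \<le> norm (x - i) + norm (y - j)"
      by (rule norm_diff_triangle_ineq)
    finally show "infdist (x + y) I \<le> infdist x I + infdist y I + e"
      using ij by linarith
  qed
  have scale_le: "infdist (scalar c * x) I \<le> cmod c * infdist x I" for c x
  proof -
    have *: "infdist (scalar c * x) I \<le> cmod c * norm (x - i)" if "i \<in> I" for i
      using le[OF ring_idealD(3)[OF I that, of "scalar c"], of "scalar c * x"]
      by (simp only: right_diff_distrib[symmetric] norm_scalar_mult)
    have "infdist (scalar c * x) I \<le> cmod c * (infdist x I + e)" if e: "e > 0" for e
    proof -
      obtain i where "i \<in> I" "norm (x - i) < infdist x I + e" using near[OF e] by blast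
      then show ?thesis using * by (meson less_imp_le mult_left_mono norm_ge_zero order_trans)
    qed
    then have "\<forall>\<^sub>F e in at_right 0. infdist (scalar c * x) I \<le> cmod c * (infdist x I + e)"
      by (simp add: eventually_at_filter)
    moreover have "((\<lambda>e. cmod c * (infdist x I + e)) \<longlongrightarrow> cmod c * (infdist x I + 0)) (at_right 0)"
      by (intro tendsto_intros)
    ultimately show ?thesis
      using tendsto_lowerbound[of _ _ "at_right (0::real)"] by fastforce
  qed
  show "infdist (scalar c * x) I = cmod c * infdist x I" for c x
  proof (cases "c = 0")
    case True
    then show ?thesis using ring_idealD(1)[OF I] by simp
  next
    case False
    have "infdist x I = infdist (scalar (inverse c) * (scalar c * x)) I"
      using False by (simp add: mult.assoc[symmetric] scalar_mult[symmetric])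
    also have "\<dots> \<le> cmod (inverse c) * infdist (scalar c * x) I"
      by (rule scale_le)
    finally have "cmod c * infdist x I \<le> cmod c * (cmod (inverse c) * infdist (scalar c * x) I)"
      by (rule mult_left_mono) simp
    also have "\<dots> = infdist (scalar c * x) I"
      using False by (simp add: norm_inverse)
    finally have "cmod c * infdist x I \<le> infdist (scalar c * x) I" .
    then show ?thesis using scale_le[of c x] by simp
  qed
  show "infdist (x * y) I \<le> infdist x I * infdist y I" for x y
  proof -
    have "infdist (x * y) I \<le> (infdist x I + e) * (infdist y I + e)" if e: "e > 0" for e
    proof -
      obtain i j where ij: "i \<in> I" "j \<in> I"
        "norm (x - i) < infdist x I + e" "norm (y - j) < infdist y I + e"
        using near[OF e] by meson
      have "(x - i) * (y - j) = x * y - (i * y + (x - i) * j)"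
        by (simp add: algebra_simps)
      moreover have "i * y + (x - i) * j \<in> I"
        using ij ring_idealD(2-4)[OF I] by blast
      ultimately have "infdist (x * y) I \<le> norm ((x - i) * (y - j))"
        using le by metis
      also have "\<dots> \<le> norm (x - i) * norm (y - j)" by (rule norm_mult_ineq)
      also have "\<dots> \<le> (infdist x I + e) * (infdist y I + e)"
        using ij e by (intro mult_mono) (auto intro: add_nonneg_nonneg infdist_nonneg)
      finally show ?thesis .
    qed
    then have "\<forall>\<^sub>F e in at_right 0. infdist (x * y) I \<le> (infdist x I + e) * (infdist y I + e)"
      by (simp add: eventually_at_filter)
    moreover have "((\<lambda>e. (infdist x I + e) * (infdist y I + e)) \<longlongrightarrow>
        (infdist x I + 0) * (infdist y I + 0)) (at_right 0)"
      by (intro tendsto_intros)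
    ultimately show ?thesis
      using tendsto_lowerbound[of _ _ "at_right (0::real)"] by fastforce
  qed
qed

section \<open>Maximal ideals and characters\<close>

definition maximal_ideal :: "'a::comm_complex_banach_algebra set \<Rightarrow> bool"
  where "maximal_ideal I \<longleftrightarrow> ring_ideal I \<and> 1 \<notin> I \<and>
    (\<forall>J. ring_ideal J \<and> 1 \<notin> J \<and> I \<subseteq> J \<longrightarrow> J = I)"

lemma maximal_idealD:
  "maximal_ideal I \<Longrightarrow> ring_ideal J \<Longrightarrow> 1 \<notin> J \<Longrightarrow> I \<subseteq> J \<Longrightarrow> J = I"
  by (simp add: maximal_ideal_def)

lemma ex_maximal_ideal:
  assumes J: "ring_ideal J" "1 \<notin> J"
  shows "\<exists>I. maximal_ideal I \<and> J \<subseteq> I"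
proof -
  let ?P = "{K. ring_ideal K \<and> 1 \<notin> K \<and> J \<subseteq> K}"
  have "\<exists>M\<in>?P. \<forall>X\<in>?P. M \<subseteq> X \<longrightarrow> X = M"
  proof (rule subset_Zorn_nonempty)
    show "?P \<noteq> {}" using J by blast
    fix C assume C: "C \<noteq> {}" "subset.chain ?P C"
    then have CP: "K \<in> ?P" if "K \<in> C" for K
      using that by (auto simp: subset.chain_def)
    have "x + y \<in> \<Union>C" if "x \<in> \<Union>C" "y \<in> \<Union>C" for x y
    proof -
      obtain K L where KL: "x \<in> K" "K \<in> C" "y \<in> L" "L \<in> C" using \<open>x \<in> \<Union>C\<close> \<open>y \<in> \<Union>C\<close> by blast
      then have "K \<subseteq> L \<or> L \<subseteq> K"
        using C(2) by (auto simp: subset_chain_def)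
      then show ?thesis
      proof
        assume "K \<subseteq> L"
        then have "x + y \<in> L" using KL CP by (intro ring_idealD(2)) auto
        then show ?thesis using KL by blast
      next
        assume "L \<subseteq> K"
        then have "x + y \<in> K" using KL CP by (intro ring_idealD(2)) auto
        then show ?thesis using KL by blast
      qed
    qed
    moreover have "a * x \<in> \<Union>C" if "x \<in> \<Union>C" for a x
      using that CP ring_idealD(3) by blast
    moreover have "0 \<in> \<Union>C" using C(1) CP ring_idealD(1) by blast
    ultimately have "ring_ideal (\<Union>C)" by (simp add: ring_ideal_def del: Union_iff)
    then show "\<Union>C \<in> ?P" using C(1) CP by blast
  qed
  then obtain M where M: "M \<in> ?P" "\<forall>X\<in>?P. M \<subseteq> X \<longrightarrow> X = M" ..
  have "X = M" if "ring_ideal X" "1 \<notin> X" "M \<subseteq> X" for X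
  proof -
    have "X \<in> ?P" using that M(1) by auto
    then show ?thesis using M(2) that(3) by simp
  qed
  then have "maximal_ideal M" using M(1) by (simp add: maximal_ideal_def)
  then show ?thesis using M(1) by (intro exI[of _ M]) simp
qed

lemma ring_ideal_plus_principal:
  assumes I: "ring_ideal I"
  shows "ring_ideal {i + b * x | i b. i \<in> I}"
  unfolding ring_ideal_def
proof (intro conjI ballI allI)
  show "0 \<in> {i + b * x | i b. i \<in> I}"
    using ring_idealD(1)[OF I] by (intro CollectI exI[of _ 0]) simp
next
  fix y z assume "y \<in> {i + b * x | i b. i \<in> I}" "z \<in> {i + b * x | i b. i \<in> I}"
  then obtain i b j c where "y = i + b * x" "z = j + c * x" "i \<in> I" "j \<in> I" by blast
  then have "y + z = (i + j) + (b + c) * x" "i + j \<in> I"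
    using ring_idealD(2)[OF I] by (auto simp: algebra_simps)
  then show "y + z \<in> {i + b * x | i b. i \<in> I}" by blast
next
  fix a y assume "y \<in> {i + b * x | i b. i \<in> I}"
  then obtain i b where "y = i + b * x" "i \<in> I" by blast
  then have "a * y = a * i + (a * b) * x" "a * i \<in> I"
    using ring_idealD(3)[OF I] by (auto simp: distrib_left mult.assoc)
  then show "a * y \<in> {i + b * x | i b. i \<in> I}" by blast
qed

lemma maximal_ideal_inverse:
  assumes "maximal_ideal I" and x: "x \<notin> I"
  shows "\<exists>b. 1 - b * x \<in> I"
proof -
  let ?J = "{i + b * x | i b. i \<in> I}"
  have I: "ring_ideal I" using assms by (simp add: maximal_ideal_def)
  have "i \<in> ?J" if "i \<in> I" for i
    using that by (intro CollectI exI[of _ i] exI[of _ 0]) simp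
  then have "I \<subseteq> ?J" by (rule subsetI)
  have "x \<in> ?J"
    using ring_idealD(1)[OF I] by (intro CollectI exI[of _ 0] exI[of _ 1]) simp
  have "1 \<in> ?J"
  proof (rule ccontr)
    assume "1 \<notin> ?J"
    then have "?J = I"
      using \<open>I \<subseteq> ?J\<close> by (rule maximal_idealD[OF assms(1) ring_ideal_plus_principal[OF I]])
    then show False using x \<open>x \<in> ?J\<close> by (simp only:)
  qed
  then obtain i b where "1 = i + b * x" "i \<in> I" by blast
  then show ?thesis by (metis add_diff_cancel_right')
qed

text \<open>
  Gelfand--Mazur yields a scalar \<open>u\<close> for which \<open>scalar u - a\<close> is not invertible modulo \<open>I\<close>;
  by maximality it lies in \<open>I\<close>.
\<close>

lemma maximal_ideal_scalar:
  assumes "maximal_ideal I"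
  shows "\<exists>u. scalar u - a \<in> I"
proof (rule ccontr)
  assume none: "\<nexists>u. scalar u - a \<in> I"
  have I: "ring_ideal I" "1 \<notin> I" using assms by (auto simp: maximal_ideal_def)
  interpret algebra_seminorm "\<lambda>x. infdist x I"
    using I by (intro algebra_seminorm_infdist)
  have "infdist 1 I > 0" using one_le_infdist_one[OF I] by simp
  then obtain u where "\<forall>b. infdist (1 - b * (scalar u - a)) I \<noteq> 0"
    using gelfand_mazur by blast
  then have "\<forall>b. 1 - b * (scalar u - a) \<notin> I" using infdist_zero by blast
  then show False using maximal_ideal_inverse[OF assms] none by blast
qed

lemma scalar_mem_ideal_iff:
  assumes "ring_ideal I" "1 \<notin> I"
  shows "scalar c \<in> I \<longleftrightarrow> c = 0"
proof
  show "c = 0" if "scalar c \<in> I"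
  proof (rule ccontr)
    assume "c \<noteq> 0"
    then have "scalar (inverse c) * scalar c = (1::'a)"
      by (simp add: scalar_mult[symmetric])
    then show False using ring_idealD(3)[OF assms(1) that, of "scalar (inverse c)"] assms(2) by simp
  qed
qed (use ring_idealD(1)[OF assms(1)] in simp)

text \<open>
  The character takes \<open>a\<close> to the scalar congruent to \<open>a\<close> modulo \<open>I\<close>. The scalar is unique, as
  a proper ideal contains no nonzero scalar, and uniqueness reduces every algebraic property
  to closure of \<open>I\<close> under the ring operations.
\<close>

lemma maximal_ideal_character:
  assumes "maximal_ideal I"
  shows "\<exists>\<phi>\<in>character_space. \<forall>u a. scalar u - a \<in> I \<longrightarrow> \<phi> a = u"
proof -
  have I: "ring_ideal I" "1 \<notin> I" using assms by (auto simp: maximal_ideal_def)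
  obtain \<phi> where \<phi>: "\<And>a. scalar (\<phi> a) - a \<in> I"
    using maximal_ideal_scalar[OF assms] by metis
  have unique: "\<phi> a = u" if "scalar u - a \<in> I" for a u
  proof -
    have "scalar (\<phi> a - u) \<in> I"
      using ring_ideal_diff[OF I(1) \<phi>[of a] that] by (simp add: scalar_diff)
    then show ?thesis using scalar_mem_ideal_iff[OF I] by simp
  qed
  have add: "\<phi> (x + y) = \<phi> x + \<phi> y" for x y
    using ring_idealD(2)[OF I(1) \<phi>[of x] \<phi>[of y]]
    by (intro unique) (simp add: scalar_add algebra_simps)
  have mult: "\<phi> (x * y) = \<phi> x * \<phi> y" for x y
  proof (rule unique)
    have "scalar (\<phi> x * \<phi> y) - x * y = (scalar (\<phi> x) - x) * scalar (\<phi> y) + x * (scalar (\<phi> y) - y)"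
      by (simp add: scalar_mult algebra_simps)
    then show "scalar (\<phi> x * \<phi> y) - x * y \<in> I"
      using ring_idealD[OF I(1)] \<phi> by metis
  qed
  have of_scalar: "\<phi> (scalar c) = c" for c
    using ring_idealD(1)[OF I(1)] by (intro unique) simp
  have "\<phi> \<noteq> (\<lambda>_. 0)" using of_scalar[of 1] by (metis zero_neq_one)
  then have "\<phi> \<in> character_space"
    by (simp add: character_space_def add mult scaleC_scalar of_scalar)
  then show ?thesis using unique by blast
qed

lemma character_scalar:
  assumes "\<phi> \<in> character_space"
  shows "\<phi> (scalar c) = c"
proof -
  obtain x where x: "\<phi> x \<noteq> 0" using assms by (auto simp: character_space_def fun_eq_iff)
  have "\<phi> (1 * x) = \<phi> 1 * \<phi> x" using assms unfolding character_space_def by blast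
  then have "\<phi> 1 = 1" using x by simp
  then show ?thesis using assms by (simp add: character_space_def scalar_def)
qed

section \<open>The vector-valued spectrum\<close>

definition generated_ideal :: "('x \<Rightarrow> 'a::comm_complex_banach_algebra) \<Rightarrow> 'a set"
  where "generated_ideal g = {\<Sum>x\<in>F. c x * g x | F c. finite F}"

lemma generator_in_generated_ideal: "g x \<in> generated_ideal g"
  unfolding generated_ideal_def by (intro CollectI exI[of _ "{x}"] exI[of _ "\<lambda>_. 1"]) simp

lemma ring_ideal_generated_ideal: "ring_ideal (generated_ideal g)"
  unfolding ring_ideal_def generated_ideal_def
proof (intro conjI ballI allI)
  let ?J = "{\<Sum>x\<in>F. c x * g x | F c. finite F}"
  show "0 \<in> ?J" by (intro CollectI exI[of _ "{}"]) simp
next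
  fix y z
  assume "y \<in> {\<Sum>x\<in>F. c x * g x | F c. finite F}" "z \<in> {\<Sum>x\<in>F. c x * g x | F c. finite F}"
  then obtain F c H d where F: "finite F" "y = (\<Sum>x\<in>F. c x * g x)"
    and H: "finite H" "z = (\<Sum>x\<in>H. d x * g x)" by blast
  have "y = (\<Sum>x\<in>F \<union> H. (if x \<in> F then c x else 0) * g x)"
    unfolding F(2) using F(1) H(1) by (intro sum.mono_neutral_cong_left) auto
  moreover have "z = (\<Sum>x\<in>F \<union> H. (if x \<in> H then d x else 0) * g x)"
    unfolding H(2) using F(1) H(1) by (intro sum.mono_neutral_cong_left) auto
  ultimately have "y + z = (\<Sum>x\<in>F \<union> H.
      ((if x \<in> F then c x else 0) + (if x \<in> H then d x else 0)) * g x)"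
    by (simp add: sum.distrib[symmetric] distrib_right)
  moreover have "finite (F \<union> H)" using F(1) H(1) by simp
  ultimately show "y + z \<in> {\<Sum>x\<in>F. c x * g x | F c. finite F}"
    by (intro CollectI exI[of _ "F \<union> H"]
        exI[of _ "\<lambda>x. (if x \<in> F then c x else 0) + (if x \<in> H then d x else 0)"]) simp
next
  fix a y assume "y \<in> {\<Sum>x\<in>F. c x * g x | F c. finite F}"
  then obtain F c where F: "finite F" "y = (\<Sum>x\<in>F. c x * g x)" by blast
  then have "a * y = (\<Sum>x\<in>F. (a * c x) * g x)"
    by (simp add: sum_distrib_left mult.assoc)
  then show "a * y \<in> {\<Sum>x\<in>F. c x * g x | F c. finite F}" using F(1) 
    by (intro CollectI exI[of _ F] exI[of _ "\<lambda>x. a * c x"]) simp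
qed

lemma vector_spectrum_iff:
  "\<mu> \<in> vector_spectrum f \<longleftrightarrow>
    1 \<notin> generated_ideal (\<lambda>x. scalar (\<mu> x) - f x)"
  by (auto simp: vector_spectrum_def generated_ideal_def scalar_def)

lemma character_comp_in_vector_spectrum:
  assumes \<phi>: "\<phi> \<in> character_space"
  shows "\<phi> \<circ> f \<in> vector_spectrum f"
proof -
  have add: "\<phi> (x + y) = \<phi> x + \<phi> y" and mult: "\<phi> (x * y) = \<phi> x * \<phi> y" for x y
    using \<phi> by (auto simp: character_space_def)
  have zero: "\<phi> 0 = 0" using add[of 0 0] by simp
  have vanish: "\<phi> (scalar (\<phi> a) - a) = 0" for a
    using add[of "scalar (\<phi> a) - a" a] by (simp add: character_scalar[OF \<phi>])
  have "\<phi> (\<Sum>x\<in>F. c x * (scalar (\<phi> (f x)) - f x)) = 0" for F c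
    by (induction F rule: infinite_finite_induct) (simp_all add: zero add mult vanish)
  then have "1 \<noteq> (\<Sum>x\<in>F. c x * (scalar (\<phi> (f x)) - f x))" for F c
    using character_scalar[OF \<phi>, of 1] by (metis scalar_1 zero_neq_one)
  then show ?thesis unfolding vector_spectrum_iff generated_ideal_def by simp
qed

theorem theorem3p1:
  fixes f :: "'x \<Rightarrow> 'a::comm_complex_banach_algebra"
  shows "vector_spectrum f = {\<phi> \<circ> f | \<phi>. \<phi> \<in> character_space}"
proof
  show "{\<phi> \<circ> f | \<phi>. \<phi> \<in> character_space} \<subseteq> vector_spectrum f"
    using character_comp_in_vector_spectrum by blast
  show "vector_spectrum f \<subseteq> {\<phi> \<circ> f | \<phi>. \<phi> \<in> character_space}"
  proof
    fix \<mu> assume \<mu>: "\<mu> \<in> vector_spectrum f"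
    let ?J = "generated_ideal (\<lambda>x. scalar (\<mu> x) - f x)"
    have "1 \<notin> ?J" using \<mu> by (simp only: vector_spectrum_iff not_False_eq_True)
    then obtain I where I: "maximal_ideal I" "?J \<subseteq> I"
      using ex_maximal_ideal[OF ring_ideal_generated_ideal] by blast
    have "scalar (\<mu> x) - f x \<in> I" for x
      using I(2) generator_in_generated_ideal[of "\<lambda>x. scalar (\<mu> x) - f x" x] by (rule subsetD)
    then obtain \<phi> where "\<phi> \<in> character_space" "\<And>x. \<phi> (f x) = \<mu> x"
      using maximal_ideal_character[OF I(1)] by blast
    moreover from this have "\<mu> = \<phi> \<circ> f" by (simp add: fun_eq_iff)
    ultimately show "\<mu> \<in> {\<phi> \<circ> f | \<phi>. \<phi> \<in> character_space}" by blast
  qed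
qed

end
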